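(* Let $q$ be a prime power and let $k,m,t$ be positive integers satisfying $m+t\leq k$. Then for each of the following three sets of parameters, every $(K,M,N)$ caching system with the given $K$ and the given ratio $\frac{M}{N}$ admits an $F$-division caching scheme with rate $R$: 1) $K=\begin{bmatrix} k \\ t \end{bmatrix}_q$, $\ \frac{M}{N}=1-\dfrac{\begin{bmatrix} k-t \\ m \end{bmatrix}_q}{\begin{bmatrix} k \\ m \end{bmatrix}_q}$, $\ R=\dfrac{\begin{bmatrix} k \\ m+t \end{bmatrix}_q}{\begin{bmatrix} k \\ m \end{bmatrix}_q}$, $\ F=\begin{bmatrix} k \\ m \end{bmatrix}_q$; 2) $K=\begin{bmatrix} k \\ t \end{bmatrix}_q$, $\ \frac{M}{N}=1-\dfrac{\begin{bmatrix} k-t \\ m \end{bmatrix}_q}{\begin{bmatrix} k \\ m+t \end{bmatrix}_q}$, $\ R=\dfrac{\begin{bmatrix} k \\ m \end{bmatrix}_q}{\begin{bmatrix} k \\ m+t \end{bmatrix}_q}$, $\ F=\begin{bmatrix} k \\ m+t \end{bmatrix}_q$; 3) $K=\begin{bmatrix} k \\ m+t \end{bmatrix}_q$, $\ \frac{M}{N}=1-\dfrac{\begin{bmatrix} m+t \\ t \end{bmatrix}_q}{\begin{bmatrix} k \\ t \end{bmatrix}_q}$, $\ R=\dfrac{\begin{bmatrix} k \\ m \end{bmatrix}_q}{\begin{bmatrix} k \\ t \end{bmatrix}_q}$, $\ F=\begin{bmatrix} k \\ t \end{bmatrix}_q$.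
   Context: Gaussian binomial coefficient: for integers $0\le m\le \ell$, $\begin{bmatrix} \ell \\ m \end{bmatrix}_q=\prod_{i=0}^{m-1}\frac{q^{\ell-i}-1}{q^{m-i}-1}$. Caching system and caching scheme: fix a finite field $\mathbb{F}$ (e.g. $\mathbb{F}=\mathbb{F}_2$), and write $[n]=\{1,\dots,n\}$. A $(K,M,N)$ caching system consists of one server with $N$ files $\mathbf{W}_1,\dots,\mathbf{W}_N$ and $K$ users, each with a cache of size $M$, $0\le M\le N$. For a positive integer $F$ (the subpacketization; with $MF$ an integer), each file is a vector $\mathbf{W}_i\in\mathbb{F}^F$. An $F$-division caching scheme with rate $R$ for the $(K,M,N)$ caching system consists of: caching functions $\phi_k:\mathbb{F}^{NF}\to\mathbb{F}^{MF}$ for $k\in[K]$; encoding functions $\varphi_{\mathbf{d}}:\mathbb{F}^{NF}\to\mathbb{F}^{\lfloor RF\rfloor}$ for $\mathbf{d}\in[N]^K$; and decoding functions $\mu_{k,\mathbf{d}}:\mathbb{F}^{MF}\times\mathbb{F}^{\lfloor RF\rfloor}\to\mathbb{F}^{F}$ for $k\in[K]$, $\mathbf{d}\in[N]^K$; such that for all $k\in[K]$, all $\mathbf{d}=(d_1,\dots,d_K)\in[N]^K$, and all files $\mathbf{W}_1,\dots,\mathbf{W}_N\in\mathbb{F}^F$, $$\mathbf{W}_{d_k}=\mu_{k,\mathbf{d}}\bigl(\phi_k(\mathbf{W}_1,\dots,\mathbf{W}_N),\ \varphi_{\mathbf{d}}(\mathbf{W}_1,\dots,\mathbf{W}_N)\bigr).$$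 *)

theory Defs
  imports Complex_Main "HOL-Library.FuncSet" "HOL-Library.NList" "HOL-Number_Theory.Prime_Powers"
begin

text \<open>Real-valued, so that no integer division is involved; only meant for \<open>m \<le> l\<close>,
  where the natural-number differences below do not truncate.\<close>

definition gauss_binomial :: "nat \<Rightarrow> nat \<Rightarrow> nat \<Rightarrow> real" where
  "gauss_binomial q l m = (\<Prod>i<m. (real q ^ (l - i) - 1) / (real q ^ (m - i) - 1))"

definition caching_system :: "nat \<Rightarrow> real \<Rightarrow> nat \<Rightarrow> bool" where
  "caching_system K M N \<longleftrightarrow> 0 < K \<and> 0 < N \<and> 0 \<le> M \<and> M \<le> real N"

text \<open>Users and files are numbered from 0. The vectors of length \<open>n\<close> over the finite field
  \<open>'f\<close> are \<open>nlists n UNIV\<close>. The files form a list \<open>W\<close> of \<open>N\<close> vectors of length \<open>F\<close>, and \<open>concat W\<close> is the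
  corresponding vector of length \<open>N * F\<close>. A demand \<open>d\<close> is a list of length \<open>K\<close> of file indices.\<close>

definition caching_scheme ::
  "nat \<Rightarrow> real \<Rightarrow> nat \<Rightarrow> nat \<Rightarrow> real \<Rightarrow>
   (nat \<Rightarrow> 'f :: {finite, field} list \<Rightarrow> 'f list) \<Rightarrow>
   (nat list \<Rightarrow> 'f list \<Rightarrow> 'f list) \<Rightarrow>
   (nat \<Rightarrow> nat list \<Rightarrow> 'f list \<Rightarrow> 'f list \<Rightarrow> 'f list) \<Rightarrow> bool" where
  "caching_scheme K M N F R cache enc dec \<longleftrightarrow>
     0 < F \<and> M * real F \<in> \<nat> \<and> 0 \<le> R \<and>
     (let files = nlists (N * F) (UNIV :: 'f set);
          contents = nlists (nat \<lfloor>M * real F\<rfloor>) (UNIV :: 'f set);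
          signals = nlists (nat \<lfloor>R * real F\<rfloor>) (UNIV :: 'f set);
          file = nlists F (UNIV :: 'f set);
          demands = nlists K {..<N}
      in (\<forall>k<K. cache k \<in> files \<rightarrow> contents) \<and>
         (\<forall>d\<in>demands. enc d \<in> files \<rightarrow> signals) \<and>
         (\<forall>k<K. \<forall>d\<in>demands. dec k d \<in> contents \<rightarrow> signals \<rightarrow> file) \<and>
         (\<forall>k<K. \<forall>d\<in>demands. \<forall>W\<in>nlists N file.
            W ! (d ! k) = dec k d (cache k (concat W)) (enc d (concat W))))"

definition admits_caching_scheme ::
  "'f :: {finite, field} itself \<Rightarrow> nat \<Rightarrow> real \<Rightarrow> nat \<Rightarrow> nat \<Rightarrow> real \<Rightarrow> bool" where
  "admits_caching_scheme _ K M N F R \<longleftrightarrow>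
     (\<exists>(cache :: nat \<Rightarrow> 'f list \<Rightarrow> 'f list) enc dec. caching_scheme K M N F R cache enc dec)"

end

(*
  Let V be a k-dimensional space over the field with q elements. In every (m+t)-dimensional subspace
  S of V the relation "T and C are complementary in S" between t- and m-dimensional subspaces of S is
  regular, so by Hall's theorem there is an injection T |-> C_S(T) sending every T to a complement.
  The triples (T, C_S(T), S) have the property that H a b c', H a b' c and H a' b c force a = a',
  b = b' and c = c'. Any such triple system yields a caching scheme in which a is a user, b a packet
  of each file that user a does not cache, and c the transmission containing the packet b demanded
  by a: all other packets summed up in transmission c are cached by a. The three parts of the theorem
  use the roles (user, packet, transmission) = (T, C, S), (T, S, C) and (S, T, C).

  The field with q = p^n elements and the space V are the sets of roots of X^(p^n) - X and
  X^(p^(n k)) - X in an algebraic closure of the prime field.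
*)
theory Submission
  imports Defs "HOL-Algebra.Algebraic_Closure" "HOL-Number_Theory.Residues"
begin

section \<open>Caching schemes from triple systems\<close>

lemma concat_nth_uniform:
  assumes "\<forall>w\<in>set W. length w = F" "n < length W" "b < F"
  shows "concat W ! (n * F + b) = W ! n ! b"
  using assms
proof (induction W arbitrary: n)
  case (Cons w W)
  then show ?case
    by (cases n) (auto simp: nth_append)
qed simp

text \<open>Join two elements whenever some triple contains both. The condition says that the
  triples are exactly the triangles of this tripartite graph and that no two triples share an edge.
  Equivalently, for fixed \<open>c\<close> the pairs \<open>(a, b)\<close> with
  \<open>H a b c\<close> form an induced matching in the graph of all pairs that lie in some
  triple.\<close>

definition triple_system :: "'a set \<Rightarrow> 'b set \<Rightarrow> 'c set \<Rightarrow> ('a \<Rightarrow> 'b \<Rightarrow> 'c \<Rightarrow> bool) \<Rightarrow> bool" where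
  "triple_system A B C H \<longleftrightarrow>
     (\<forall>a b c. H a b c \<longrightarrow> a \<in> A \<and> b \<in> B \<and> c \<in> C) \<and>
     (\<forall>a b c a' b' c'. H a b c' \<longrightarrow> H a b' c \<longrightarrow> H a' b c \<longrightarrow> a = a' \<and> b = b' \<and> c = c')"

text \<open>The condition treats the three coordinates alike. This lemma and the next one let a
  single triple system serve under all three assignments of the roles user, packet and
  transmission.\<close>

lemma triple_system_swap23:
  "triple_system A B C H \<Longrightarrow> triple_system A C B (\<lambda>a c b. H a b c)"
  unfolding triple_system_def by metis

lemma triple_system_rotate:
  "triple_system A B C H \<Longrightarrow> triple_system C A B (\<lambda>c a b. H a b c)"
  unfolding triple_system_def by metis

text \<open>User \<open>a\<close> misses the \<open>D\<close> packets \<open>b\<close> that occur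
  with \<open>a\<close> in a triple and caches the other \<open>F - D\<close> packets of every file,
  uncoded. The equation for \<open>M\<close> says that this fills the cache. The signal has one
  symbol for each \<open>c\<close>, which gives rate \<open>S / F\<close>.\<close>

lemma triple_system_caching_scheme_nat:
  fixes H :: "nat \<Rightarrow> nat \<Rightarrow> nat \<Rightarrow> bool"
  assumes H: "triple_system {..<K} {..<F} {..<S} H"
    and deg: "\<And>a. a < K \<Longrightarrow> card {b. \<exists>c. H a b c} = D"
    and "0 < F" and "0 < K" and M: "M * real F = real N * (real F - real D)"
  shows "admits_caching_scheme TYPE('f :: {finite, field}) K M N F (real S / real F)"
proof -
  have dom: "a < K \<and> b < F \<and> c < S" if "H a b c" for a b c
    using H that unfolding triple_system_def by blast
  have tri: "a = a' \<and> b = b' \<and> c = c'" if "H a b c'" "H a b' c" "H a' b c" for a b c a' b' c'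
    using H that unfolding triple_system_def by metis
  define stored where "stored a = filter (\<lambda>b. \<nexists>c. H a b c) [0..<F]" for a
  define cache where "cache a x = map (\<lambda>(n, b). x ! (n * F + b)) (List.product [0..<N] (stored a))"
    for a and x :: "'f list"
  define enc where "enc d x = map (\<lambda>c. \<Sum>(a, b)\<in>{(a, b). H a b c}. x ! (d ! a * F + b)) [0..<S]"
    for d :: "nat list" and x :: "'f list"
  define packets where "packets = nlists F (UNIV :: 'f set)"
  define good where "good a d y z W \<longleftrightarrow> W \<in> nlists N packets \<and> cache a (concat W) = y \<and> enc d (concat W) = z"
    for a d y z W
  \<comment> \<open>Decoding is by choice, so only the uniqueness of the decoded file has to be shown.\<close>
  define dec where "dec a d y z = (if \<exists>W. good a d y z W then (SOME W. good a d y z W) ! (d ! a)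
      else replicate F 0)" for a d y z
  have sub: "{b. \<exists>c. H a b c} \<subseteq> {..<F}" for a
    using dom by blast
  have len_stored: "length (stored a) = F - D" if "a < K" for a
  proof -
    have "length (stored a) = card (set (stored a))"
      by (metis distinct_card distinct_filter distinct_upt stored_def)
    also have "set (stored a) = {..<F} - {b. \<exists>c. H a b c}"
      by (auto simp: stored_def)
    also have "card \<dots> = card {..<F} - card {b. \<exists>c. H a b c}"
      by (intro card_Diff_subset finite_subset[OF sub] sub) simp
    finally show ?thesis
      using deg[OF that] by simp
  qed
  \<comment> \<open>This rules out truncation in \<open>F - D\<close>. Since \<open>K\<close> is
    positive there is a user 0, whose \<open>D\<close> missing packets lie among the
    \<open>F\<close> packets.\<close>
  have "D \<le> F"
    using deg[OF \<open>0 < K\<close>] sub[of 0] card_mono[of "{..<F}"] by fastforce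
  then have MF: "M * real F = real (N * (F - D))"
    using M by simp
  have same: "W ! (d ! a) = W' ! (d ! a)"
    if a: "a < K" and d: "d \<in> nlists K {..<N}" and W: "W \<in> nlists N packets" and W': "W' \<in> nlists N packets"
      and c: "cache a (concat W) = cache a (concat W')" and e: "enc d (concat W) = enc d (concat W')"
    for a d W W'
  proof -
    have unif: "\<forall>w\<in>set W. length w = F" if "W \<in> nlists N packets" for W
      using nlistsE_set[OF that] nlistsE_length unfolding packets_def by blast
    have dN: "d ! a' < N" if "a' < K" for a'
      using nlistsE_nth_in[OF d that] by simp
    have nth: "concat W ! (n * F + b) = W ! n ! b" "concat W' ! (n * F + b) = W' ! n ! b"
      if "n < N" "b < F" for n b
      using that concat_nth_uniform[OF unif[OF W]] concat_nth_uniform[OF unif[OF W']]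
        nlistsE_length[OF W] nlistsE_length[OF W'] by metis+
    have st: "W ! n ! b = W' ! n ! b" if "n < N" "b < F" "\<nexists>c. H a b c" for n b
    proof -
      have "(n, b) \<in> set (List.product [0..<N] (stored a))"
        using that by (auto simp: stored_def)
      with c have "concat W ! (n * F + b) = concat W' ! (n * F + b)"
        unfolding cache_def map_eq_conv by fast
      then show ?thesis using nth that by simp
    qed
    have "W ! (d ! a) ! b = W' ! (d ! a) ! b" if b: "b < F" for b
    proof (cases "\<exists>c. H a b c")
      case False
      then show ?thesis using st dN a b by blast
    next
      case True
      then obtain c where abc: "H a b c" by blast
      let ?E = "{(a, b). H a b c}"
      have "?E \<subseteq> {..<K} \<times> {..<F}" using dom by auto
      then have fin: "finite ?E" by (rule finite_subset) simp
      have "(\<Sum>(a', b')\<in>?E. concat W ! (d ! a' * F + b')) = (\<Sum>(a', b')\<in>?E. concat W' ! (d ! a' * F + b'))"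
        using e dom[OF abc] by (auto simp: enc_def)
      \<comment> \<open>Every other summand is known to user \<open>a\<close>: if
        \<open>H a' b' c\<close> and \<open>b'\<close> were missing at \<open>a\<close>, say
        \<open>H a b' c'\<close>, then these two triples together with \<open>H a b c\<close> would
        force \<open>(a', b') = (a, b)\<close>. Hence only the wanted packet remains in the equation
        between the two sums.\<close>
      moreover have "(\<Sum>(a', b')\<in>?E - {(a, b)}. concat W ! (d ! a' * F + b')) =
          (\<Sum>(a', b')\<in>?E - {(a, b)}. concat W' ! (d ! a' * F + b'))"
      proof (rule sum.cong[OF refl])
        fix p assume "p \<in> ?E - {(a, b)}"
        then obtain a' b' where h: "p = (a', b')" "H a' b' c" "(a', b') \<noteq> (a, b)" by blast
        then have "\<nexists>c'. H a b' c'"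
          using tri abc by blast
        then have "concat W ! (d ! a' * F + b') = concat W' ! (d ! a' * F + b')"
          using dom[OF h(2)] dN nth st by metis
        then show "(case p of (a', b') \<Rightarrow> concat W ! (d ! a' * F + b')) =
            (case p of (a', b') \<Rightarrow> concat W' ! (d ! a' * F + b'))"
          by (simp add: h(1))
      qed
      ultimately have "concat W ! (d ! a * F + b) = concat W' ! (d ! a * F + b)"
        using abc by (simp add: sum.remove[OF fin, of "(a, b)"])
      then show ?thesis using nth dN a b by simp
    qed
    moreover have "length (W ! (d ! a)) = F" "length (W' ! (d ! a)) = F"
      using nlistsE_nth_in[OF W dN[OF a]] nlistsE_nth_in[OF W' dN[OF a]] unfolding packets_def by (metis nlistsE_length)+
    ultimately show ?thesis
      by (intro nth_equalityI) auto
  qed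
  have good: "good a d y z (SOME W. good a d y z W)" if "good a d y z W" for a d y z W
    using that by (rule someI)
  have dec_mem: "dec a d y z \<in> packets" if "a < K" "d \<in> nlists K {..<N}" for a d y z
  proof (cases "\<exists>W. good a d y z W")
    case True
    then have "(SOME W. good a d y z W) \<in> nlists N packets"
      using good good_def by blast
    then have "(SOME W. good a d y z W) ! (d ! a) \<in> packets"
      using nlistsE_nth_in[OF that(2,1)] by (simp add: nlistsE_nth_in)
    then show ?thesis
      using True by (simp add: dec_def)
  next
    case False
    then show ?thesis by (auto simp: dec_def packets_def intro: nlists_replicateI)
  qed
  have dec_eq: "W ! (d ! a) = dec a d (cache a (concat W)) (enc d (concat W))"
    if "a < K" "d \<in> nlists K {..<N}" "W \<in> nlists N packets" for a d W
  proof -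
    have g: "good a d (cache a (concat W)) (enc d (concat W)) W"
      using that by (simp add: good_def)
    have "W ! (d ! a) = (SOME W'. good a d (cache a (concat W)) (enc d (concat W)) W') ! (d ! a)"
      using good[OF g] that by (intro same) (auto simp: good_def)
    with g show ?thesis
      unfolding dec_def by metis
  qed
  have cache_mem: "cache a x \<in> nlists (N * (F - D)) UNIV" if "a < K" for a x
    using len_stored[OF that] by (intro nlistsI) (simp_all add: cache_def)
  have enc_mem: "enc d x \<in> nlists S UNIV" for d x
    by (intro nlistsI) (simp_all add: enc_def)
  have RF: "real S / real F * real F = real S"
    using \<open>0 < F\<close> by simp
  have "caching_scheme K M N F (real S / real F) cache enc dec"
    unfolding caching_scheme_def Let_def MF RF floor_of_nat nat_int packets_def[symmetric]
    using \<open>0 < F\<close> dec_mem dec_eq cache_mem enc_mem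
    by (intro conjI allI impI ballI funcsetI) simp_all
  then show ?thesis
    unfolding admits_caching_scheme_def by blast
qed

text \<open>Enumerating the three finite sets reduces this to the version on initial segments of the
  naturals. \<open>D\<close> is real because the degrees are later given as Gaussian
  binomials.\<close>

lemma triple_system_caching_scheme:
  fixes H :: "'a \<Rightarrow> 'b \<Rightarrow> 'c \<Rightarrow> bool"
  assumes fin: "finite A" "finite B" "finite C"
    and H: "triple_system A B C H"
    and deg: "\<And>a. a \<in> A \<Longrightarrow> real (card {b. \<exists>c. H a b c}) = D"
    and "B \<noteq> {}" and "caching_system (card A) M N"
    and M: "M / real N = 1 - D / real (card B)"
  shows "admits_caching_scheme TYPE('f :: {finite, field}) (card A) M N (card B)
           (real (card C) / real (card B))"
proof -
  have dom: "a \<in> A \<and> b \<in> B \<and> c \<in> C" if "H a b c" for a b c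
    using H that unfolding triple_system_def by blast
  have tri: "a = a' \<and> b = b' \<and> c = c'" if "H a b c'" "H a b' c" "H a' b c" for a b c a' b' c'
    using H that unfolding triple_system_def by metis
  obtain f where f: "bij_betw f {0..<card A} A"
    using ex_bij_betw_nat_finite[OF fin(1)] by blast
  obtain g where g: "bij_betw g {0..<card B} B"
    using ex_bij_betw_nat_finite[OF fin(2)] by blast
  obtain h where h: "bij_betw h {0..<card C} C"
    using ex_bij_betw_nat_finite[OF fin(3)] by blast
  define H' where "H' a b c \<longleftrightarrow> a < card A \<and> b < card B \<and> c < card C \<and> H (f a) (g b) (h c)" for a b c
  have injf: "f a = f a' \<longleftrightarrow> a = a'" if "a < card A" "a' < card A" for a a'
    using f that by (auto simp: bij_betw_def inj_on_def)
  have injg: "g a = g a' \<longleftrightarrow> a = a'" if "a < card B" "a' < card B" for a a'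
    using g that by (auto simp: bij_betw_def inj_on_def)
  have injh: "h a = h a' \<longleftrightarrow> a = a'" if "a < card C" "a' < card C" for a a'
    using h that by (auto simp: bij_betw_def inj_on_def)
  have deg': "card {b. \<exists>c. H' a b c} = nat \<lfloor>D\<rfloor>" if a: "a < card A" for a
  proof -
    have "f a \<in> A" using f a by (auto simp: bij_betw_def)
    have "g ` {b. \<exists>c. H' a b c} = {b. \<exists>c. H (f a) b c}"
    proof safe
      fix b c assume "H (f a) b c"
      with dom have "b \<in> g ` {0..<card B}" "c \<in> h ` {0..<card C}"
        using g h by (auto simp: bij_betw_def)
      then obtain b' c' where "b' < card B" "b = g b'" "c' < card C" "c = h c'"
        by auto
      with \<open>H (f a) b c\<close> a show "b \<in> g ` {b. \<exists>c. H' a b c}"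
        by (auto simp: H'_def)
    qed (auto simp: H'_def)
    moreover have "inj_on g {b. \<exists>c. H' a b c}"
      using injg by (auto simp: inj_on_def H'_def)
    ultimately have "card {b. \<exists>c. H' a b c} = card {b. \<exists>c. H (f a) b c}"
      by (metis card_image)
    then show ?thesis
      using deg[OF \<open>f a \<in> A\<close>] by linarith
  qed
  have pos: "0 < card A" "0 < N" "0 < card B"
    using assms by (auto simp: caching_system_def card_gt_0_iff)
  \<comment> \<open>There is at least one user, so \<open>D\<close> is the cardinality of a set, and
    rounding it down loses nothing.\<close>
  have "0 \<le> D" "D = real (nat \<lfloor>D\<rfloor>)"
  proof -
    from pos obtain a where "a \<in> A" by fastforce
    from deg[OF this] show "0 \<le> D" "D = real (nat \<lfloor>D\<rfloor>)"
      by (metis of_nat_0_le_iff, metis floor_of_nat nat_int)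
  qed
  then have "M * real (card B) = real N * (real (card B) - real (nat \<lfloor>D\<rfloor>))"
    using M pos by (simp add: field_simps)
  moreover have "triple_system {..<card A} {..<card B} {..<card C} H'"
    unfolding triple_system_def
  proof (intro conjI allI impI)
    fix a b c a' b' c' assume *: "H' a b c'" "H' a b' c" "H' a' b c"
    then have "f a = f a' \<and> g b = g b' \<and> h c = h c'"
      using tri[of "f a" "g b" "h c'" "g b'" "h c" "f a'"] unfolding H'_def by blast
    with * show "a = a'" "b = b'" "c = c'"
      using injf injg injh unfolding H'_def by blast+
  qed (simp_all add: H'_def)
  ultimately show ?thesis
    using pos deg' by (intro triple_system_caching_scheme_nat) simp_all
qed

section \<open>Matchings in regular bipartite relations\<close>

text \<open>Induction on the size of \<open>A\<close>. If some nonempty proper subset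
  \<open>Z\<close> is tight, match \<open>Z\<close> first and then \<open>A - Z\<close> outside the
  neighbours of \<open>Z\<close>. If none is tight, match an arbitrary \<open>a\<close> with an
  arbitrary neighbour \<open>b\<close> and delete both.\<close>

lemma hall_marriage:
  fixes N :: "'a \<Rightarrow> 'b set"
  assumes "finite A" and "\<And>a. a \<in> A \<Longrightarrow> finite (N a)"
    and "\<And>Z. Z \<subseteq> A \<Longrightarrow> card Z \<le> card (\<Union>(N ` Z))"
  shows "\<exists>f. inj_on f A \<and> (\<forall>a\<in>A. f a \<in> N a)"
  using assms
proof (induction "card A" arbitrary: A N rule: less_induct)
  case less
  note fin = less.prems(1) and finN = less.prems(2) and hall = less.prems(3)
  have finU: "finite (\<Union>(N ` Z))" if "Z \<subseteq> A" for Z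
    using that fin finN by (auto intro: finite_subset)
  show ?case
  proof (cases "A = {}")
    case False
    then obtain a where a: "a \<in> A" by blast
    show ?thesis
    proof (cases "\<exists>Z. Z \<subseteq> A \<and> Z \<noteq> {} \<and> Z \<noteq> A \<and> card (\<Union>(N ` Z)) = card Z")
      case True
      then obtain Z where Z: "Z \<subseteq> A" "Z \<noteq> {}" "Z \<noteq> A" "card (\<Union>(N ` Z)) = card Z" by blast
      have finX: "finite Z" using Z fin finite_subset by blast
      have "card Z < card A" using Z fin by (simp add: psubset_card_mono psubsetI)
      then have "\<exists>f. inj_on f Z \<and> (\<forall>a\<in>Z. f a \<in> N a)"
        using Z finX finN hall by (intro less.hyps) auto
      then obtain f where f: "inj_on f Z" "\<forall>a\<in>Z. f a \<in> N a" by blast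
      let ?U = "\<Union>(N ` Z)"
      have "card (A - Z) < card A"
        using Z finX fin by (intro psubset_card_mono) auto
      \<comment> \<open>Hall's condition survives on \<open>A - Z\<close>: apply the original
        condition to \<open>Z \<union> Y\<close> and subtract the neighbours of \<open>Z\<close>, of
        which there are exactly \<open>card Z\<close>.\<close>
      moreover have "card Y \<le> card (\<Union>((\<lambda>a. N a - ?U) ` Y))" if Y: "Y \<subseteq> A - Z" for Y
      proof -
        have finY: "finite Y" using Y fin finite_subset by blast
        have eq: "\<Union>(N ` (Z \<union> Y)) = ?U \<union> \<Union>((\<lambda>a. N a - ?U) ` Y)" by auto
        have "card Z + card Y = card (Z \<union> Y)"
          using Y finX finY by (subst card_Un_disjoint) auto
        also have "\<dots> \<le> card (\<Union>(N ` (Z \<union> Y)))"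
          using Z Y by (intro hall) auto
        also have "\<dots> \<le> card ?U + card (\<Union>((\<lambda>a. N a - ?U) ` Y))"
          unfolding eq by (rule card_Un_le)
        finally show ?thesis using Z by simp
      qed
      ultimately have "\<exists>g. inj_on g (A - Z) \<and> (\<forall>a\<in>A - Z. g a \<in> N a - ?U)"
        using fin finN by (intro less.hyps) auto
      then obtain g where g: "inj_on g (A - Z)" "\<forall>a\<in>A - Z. g a \<in> N a - ?U" by blast
      define h where "h a = (if a \<in> Z then f a else g a)" for a
      have "inj_on h A"
      proof (rule inj_onI)
        fix x y assume xy: "x \<in> A" "y \<in> A" "h x = h y"
        show "x = y"
        proof (cases "x \<in> Z"; cases "y \<in> Z")
          assume "x \<in> Z" "y \<in> Z"
          then show ?thesis using xy f by (simp add: h_def inj_on_def)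
        next
          assume "x \<notin> Z" "y \<notin> Z"
          then show ?thesis using xy g by (simp add: h_def inj_on_def)
        next
          assume "x \<in> Z" "y \<notin> Z"
          then have "f x \<in> ?U" "g y \<notin> ?U" "f x = g y"
            using xy f(2) g(2) by (blast, blast, simp add: h_def)
          then show ?thesis by simp
        next
          assume "x \<notin> Z" "y \<in> Z"
          then have "f y \<in> ?U" "g x \<notin> ?U" "f y = g x"
            using xy f(2) g(2) by (blast, blast, simp add: h_def)
          then show ?thesis by simp
        qed
      qed
      moreover have "\<forall>a\<in>A. h a \<in> N a" using f g by (auto simp: h_def)
      ultimately show ?thesis by blast
    next
      case nontight: False
      have "card (N a) \<ge> 1" using hall[of "{a}"] a by simp
      then obtain b where b: "b \<in> N a" by fastforce
      have "card (A - {a}) < card A"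
        using a fin by (intro psubset_card_mono) auto
      \<comment> \<open>A nonempty \<open>Y\<close> avoiding \<open>a\<close> is a proper subset of
        \<open>A\<close>, hence not tight, and so has a spare neighbour that pays for the loss of
        \<open>b\<close>.\<close>
      moreover have "card Y \<le> card (\<Union>((\<lambda>x. N x - {b}) ` Y))" if Y: "Y \<subseteq> A - {a}" for Y
      proof (cases "Y = {}")
        case False
        have "Y \<subseteq> A" "Y \<noteq> A" using Y a by auto
        then have "card Y \<noteq> card (\<Union>(N ` Y))"
          using nontight \<open>Y \<noteq> {}\<close> by metis
        with hall[of Y] Y have "card Y < card (\<Union>(N ` Y))" by fastforce
        moreover have "\<Union>((\<lambda>x. N x - {b}) ` Y) = \<Union>(N ` Y) - {b}" by auto
        ultimately show ?thesis
          by (auto simp: card_Diff_singleton_if)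
      qed simp
      ultimately have "\<exists>g. inj_on g (A - {a}) \<and> (\<forall>x\<in>A - {a}. g x \<in> N x - {b})"
        using fin finN by (intro less.hyps) auto
      then obtain g where g: "inj_on g (A - {a})" "\<forall>x\<in>A - {a}. g x \<in> N x - {b}" by blast
      then have "inj_on (g(a := b)) A \<and> (\<forall>x\<in>A. (g(a := b)) x \<in> N x)"
        using b by (auto simp: inj_on_def)
      then show ?thesis by blast
    qed
  qed simp
qed

text \<open>Hall's condition by counting edges: \<open>d * card Z\<close> edges leave
  \<open>Z\<close>, and each neighbour of \<open>Z\<close> absorbs at most \<open>d\<close> of
  them.\<close>

lemma regular_bipartite_matching:
  assumes "finite A" "finite B" "0 < d"
    and degA: "\<And>a. a \<in> A \<Longrightarrow> card {b \<in> B. R a b} = d"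
    and degB: "\<And>b. b \<in> B \<Longrightarrow> card {a \<in> A. R a b} = d"
  shows "\<exists>f. inj_on f A \<and> (\<forall>a\<in>A. f a \<in> B \<and> R a (f a))"
proof -
  have "card Z \<le> card (\<Union>a\<in>Z. {b \<in> B. R a b})" (is "_ \<le> card ?Y") if Z: "Z \<subseteq> A" for Z
  proof -
    have fin: "finite Z" "finite ?Y"
      using assms(1,2) Z by (auto intro: finite_subset[of Z A] finite_subset[of ?Y B])
    have "d * card Z = (\<Sum>a\<in>Z. card {b \<in> ?Y. R a b})"
    proof -
      have "{b \<in> ?Y. R a b} = {b \<in> B. R a b}" if "a \<in> Z" for a using that by auto
      then show ?thesis using degA Z by (simp add: subset_iff)
    qed
    also have "\<dots> = (\<Sum>b\<in>?Y. card {a \<in> Z. R a b})"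
      using fin by (intro sum_multicount_gen) auto
    also have "\<dots> \<le> (\<Sum>b\<in>?Y. d)"
    proof (rule sum_mono)
      fix b assume "b \<in> ?Y"
      then have "card {a \<in> A. R a b} = d" using degB by blast
      moreover have "card {a \<in> Z. R a b} \<le> card {a \<in> A. R a b}"
        using assms(1) Z by (intro card_mono) auto
      ultimately show "card {a \<in> Z. R a b} \<le> d" by simp
    qed
    finally show ?thesis using \<open>0 < d\<close> by simp
  qed
  then show ?thesis
    using hall_marriage[of A "\<lambda>a. {b \<in> B. R a b}"] assms(1,2) by auto
qed

section \<open>Subspaces over a finite field\<close>

text \<open>Scalars and vectors live in the same field \<open>R\<close>, and a subspace is an additive subgroup closed
  under multiplication by \<open>K\<close>. Dimension \<open>n\<close> is expressed as cardinality \<open>q ^ n\<close>.\<close>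

locale finite_scalars = field R for R (structure) +
  fixes K
  assumes K: "subfield K R" and finite_K: "finite K"
begin

abbreviation q :: nat where "q \<equiv> card K"

lemma K_carrier: "K \<subseteq> carrier R"
  using subfieldE(3)[OF K] .

lemma q_ge_2: "2 \<le> q"
proof -
  have "{\<zero>, \<one>} \<subseteq> K"
    using subringE(2,3)[OF subfieldE(1)[OF K]] by auto
  then have "card {\<zero>, \<one>} \<le> q"
    using finite_K by (rule card_mono[rotated])
  then show ?thesis by simp
qed

section \<open>Subspaces, line extensions and direct sums\<close>

lemma
  assumes "subalgebra K E R"
  shows subsp_carrier: "x \<in> E \<Longrightarrow> x \<in> carrier R"
    and subsp_zero: "\<zero> \<in> E"
    and subsp_add: "x \<in> E \<Longrightarrow> y \<in> E \<Longrightarrow> x \<oplus> y \<in> E"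
    and subsp_neg: "x \<in> E \<Longrightarrow> \<ominus> x \<in> E"
    and subsp_minus: "x \<in> E \<Longrightarrow> y \<in> E \<Longrightarrow> x \<ominus> y \<in> E"
    and subsp_smult: "k \<in> K \<Longrightarrow> x \<in> E \<Longrightarrow> k \<otimes> x \<in> E"
proof -
  have sg: "subgroup E (add_monoid R)" using assms by (simp add: subalgebra_def)
  show "x \<in> E \<Longrightarrow> x \<in> carrier R" using subalgebra_in_carrier[OF assms] by blast
  show "\<zero> \<in> E" using subgroup.one_closed[OF sg] by simp
  show add: "x \<oplus> y \<in> E" if "x \<in> E" "y \<in> E" for x y using add.subgroupE(4)[OF sg] that by simp
  show neg: "\<ominus> x \<in> E" if "x \<in> E" for x using add.subgroupE(3)[OF sg] that by simp
  show "x \<in> E \<Longrightarrow> y \<in> E \<Longrightarrow> x \<ominus> y \<in> E" using add neg by (simp add: a_minus_def)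
  show "k \<in> K \<Longrightarrow> x \<in> E \<Longrightarrow> k \<otimes> x \<in> E" using subalgebra.smult_closed[OF assms] .
qed

lemma subsp_smult_cancel:
  assumes "subalgebra K E R" "k \<in> K" "k \<noteq> \<zero>" "a \<in> carrier R" "k \<otimes> a \<in> E"
  shows "a \<in> E"
proof -
  have k: "inv k \<in> K" "inv k \<otimes> k = \<one>"
    using subfield_m_inv[OF K, of k] assms(2,3) by auto
  have "inv k \<otimes> (k \<otimes> a) \<in> E" using subsp_smult[OF assms(1) k(1) assms(5)] .
  moreover have "inv k \<otimes> (k \<otimes> a) = a"
    using k assms(2,4) K_carrier by (simp add: m_assoc[symmetric] subset_iff)
  ultimately show ?thesis by simp
qed

lemma subsp_zero_space: "subalgebra K {\<zero>} R"
  using Span_is_subalgebra[OF K, of "[]"] by simp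

lemma subsp_line_extension:
  assumes "subalgebra K E R" "a \<in> carrier R"
  shows "subalgebra K (line_extension K a E) R"
proof (intro subalgebra.intro subalgebra_axioms.intro)
  show "subgroup (line_extension K a E) (add_monoid R)"
    using line_extension_is_subgroup[OF K subalgebra.axioms(1)[OF assms(1)] assms(2)] .
  show "k \<otimes> v \<in> line_extension K a E" if "k \<in> K" "v \<in> line_extension K a E" for k v
    using line_extension_smult_closed[OF K _ subalgebra_in_carrier[OF assms(1)] assms(2) that]
      subsp_smult[OF assms(1)] by blast
qed

text \<open>The line extension is the span of \<open>a\<close> and \<open>E\<close>. In the double
  count below this turns the overspaces of \<open>C\<close> through a vector \<open>x\<close> into
  the overspaces of a single larger space.\<close>

lemma line_extension_subset_iff:
  assumes "subalgebra K E R" "subalgebra K V R" "a \<in> carrier R"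
  shows "line_extension K a E \<subseteq> V \<longleftrightarrow> a \<in> V \<and> E \<subseteq> V"
proof
  assume *: "line_extension K a E \<subseteq> V"
  have "\<one> \<otimes> a \<oplus> \<zero> \<in> line_extension K a E" "\<And>e. e \<in> E \<Longrightarrow> \<zero> \<otimes> a \<oplus> e \<in> line_extension K a E"
    using subringE(2,3)[OF subfieldE(1)[OF K]] subsp_zero[OF assms(1)]
    unfolding line_extension_mem_iff by blast+
  then have "a \<in> line_extension K a E" "\<And>e. e \<in> E \<Longrightarrow> e \<in> line_extension K a E"
    using assms(3) subsp_carrier[OF assms(1)] by auto
  with * show "a \<in> V \<and> E \<subseteq> V" by blast
next
  assume "a \<in> V \<and> E \<subseteq> V"
  then show "line_extension K a E \<subseteq> V"
    by (auto simp: line_extension_mem_iff intro!: subsp_add[OF assms(2)] subsp_smult[OF assms(2)])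
qed

text \<open>The coordinates \<open>k\<close> and \<open>e\<close> of a vector are unique: the
  difference of two representations puts \<open>(k \<ominus> k') \<otimes> a\<close> into
  \<open>E\<close>, and cancelling a nonzero scalar would put \<open>a\<close> there as
  well.\<close>

lemma card_line_extension:
  assumes E: "subalgebra K E R" and a: "a \<in> carrier R" "a \<notin> E"
  shows "card (line_extension K a E) = q * card E"
proof -
  have "inj_on (\<lambda>(k, e). k \<otimes> a \<oplus> e) (K \<times> E)"
  proof (rule inj_onI, clarify)
    fix k e k' e' assume ke: "k \<in> K" "e \<in> E" "k' \<in> K" "e' \<in> E" and eq: "k \<otimes> a \<oplus> e = k' \<otimes> a \<oplus> e'"
    have carr: "k \<in> carrier R" "k' \<in> carrier R" "e \<in> carrier R" "e' \<in> carrier R"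
      using ke K_carrier subsp_carrier[OF E] by auto
    have "(k \<ominus> k') \<otimes> a = (k \<otimes> a \<oplus> e) \<ominus> (k' \<otimes> a) \<ominus> e"
      using carr a by algebra
    also have "\<dots> = e' \<ominus> e"
      unfolding eq using carr a by algebra
    finally have d: "(k \<ominus> k') \<otimes> a = e' \<ominus> e" .
    then have "(k \<ominus> k') \<otimes> a \<in> E"
      using ke subsp_minus[OF E] by simp
    moreover have "k \<ominus> k' \<in> K"
      using ke subringE(5,7)[OF subfieldE(1)[OF K]] by (simp add: a_minus_def)
    ultimately have "k \<ominus> k' = \<zero>"
      using subsp_smult_cancel[OF E] a by blast
    moreover have "k = k'" "e' \<ominus> e = \<zero>" if k: "k \<ominus> k' = \<zero>"
    proof -
      show "k = k'" using k carr by auto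
      show "e' \<ominus> e = \<zero>" using d a unfolding k by simp
    qed
    ultimately show "k = k' \<and> e = e'"
      using carr by auto
  qed
  moreover have "line_extension K a E = (\<lambda>(k, e). k \<otimes> a \<oplus> e) ` (K \<times> E)"
    by (auto simp: line_extension_mem_iff) blast
  ultimately show ?thesis
    by (simp add: card_image card_cartesian_product)
qed

lemma subsp_sum_inj:
  assumes "subalgebra K T R" "subalgebra K C R" "T \<inter> C = {\<zero>}"
  shows "inj_on (\<lambda>(x, y). x \<oplus> y) (T \<times> C)"
proof (rule inj_onI, clarify)
  fix x y x' y' assume h: "x \<in> T" "x' \<in> T" "y \<in> C" "y' \<in> C" "x \<oplus> y = x' \<oplus> y'"
  have carr: "x \<in> carrier R" "x' \<in> carrier R" "y \<in> carrier R" "y' \<in> carrier R"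
    using h subsp_carrier assms by auto
  have "x \<ominus> x' = (x \<oplus> y) \<ominus> x' \<ominus> y" using carr by algebra
  also have "\<dots> = y' \<ominus> y" unfolding h(5) using carr by algebra
  finally have "x \<ominus> x' = y' \<ominus> y" .
  moreover have "x \<ominus> x' \<in> T" "y' \<ominus> y \<in> C" using h subsp_minus assms by auto
  ultimately have "x \<ominus> x' = \<zero>" "y' \<ominus> y = \<zero>" using assms(3) by auto
  then show "x = x' \<and> y = y'" using carr by auto
qed

lemma card_subsp_sum:
  assumes "subalgebra K T R" "subalgebra K C R" "T \<inter> C = {\<zero>}"
  shows "card (T <+>\<^bsub>R\<^esub> C) = card T * card C"
proof -
  have "T <+>\<^bsub>R\<^esub> C = (\<lambda>(x, y). x \<oplus> y) ` (T \<times> C)"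
    by (auto simp: set_add_def')
  then show ?thesis
    using subsp_sum_inj[OF assms] by (simp add: card_image card_cartesian_product)
qed

text \<open>Here cardinality does the work of a dimension formula: the direct sum lies in
  \<open>S\<close> and already has as many elements as \<open>S\<close>.\<close>

lemma complement_sum:
  assumes "subalgebra K T R" "subalgebra K C R" "T \<inter> C = {\<zero>}"
    and "subalgebra K S R" "finite S" "T \<subseteq> S" "C \<subseteq> S" "card S = card T * card C"
  shows "T <+>\<^bsub>R\<^esub> C = S"
proof (rule card_subset_eq)
  show "T <+>\<^bsub>R\<^esub> C \<subseteq> S"
    using assms(6,7) subsp_add[OF assms(4)] by (auto simp: set_add_def')
  show "card (T <+>\<^bsub>R\<^esub> C) = card S"
    using card_subsp_sum[OF assms(1-3)] assms(8) by simp
qed fact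

text \<open>If \<open>k \<otimes> x \<oplus> c\<close> lies in \<open>T\<close> with
  \<open>k\<close> nonzero, solving for \<open>x\<close> shows that \<open>x\<close> lies in the sum
  of \<open>T\<close> and \<open>C\<close>. So \<open>k\<close> is zero and the vector lies in both
  \<open>T\<close> and \<open>C\<close>.\<close>

lemma line_extension_disjoint:
  assumes T: "subalgebra K T R" and C: "subalgebra K C R" and TC: "T \<inter> C = {\<zero>}"
    and x: "x \<in> carrier R" "x \<notin> T <+>\<^bsub>R\<^esub> C"
  shows "T \<inter> line_extension K x C = {\<zero>}"
proof -
  have "u = \<zero>" if uT: "u \<in> T" and uL: "u \<in> line_extension K x C" for u
  proof -
    obtain k c where k: "k \<in> K" "c \<in> C" "u = k \<otimes> x \<oplus> c"
      using uL by (auto simp: line_extension_mem_iff)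
    have carr: "k \<in> carrier R" "c \<in> carrier R" "u \<in> carrier R"
      using k uT K_carrier subsp_carrier[OF C] subsp_carrier[OF T] by auto
    have "k = \<zero>"
    proof (rule ccontr)
      assume "k \<noteq> \<zero>"
      then have i: "inv k \<in> K" "inv k \<otimes> k = \<one>"
        using subfield_m_inv[OF K, of k] k by auto
      have ic: "inv k \<in> carrier R" using i K_carrier by auto
      have "x = (inv k \<otimes> k) \<otimes> x" using i x by simp
      also have "\<dots> = inv k \<otimes> (k \<otimes> x \<oplus> c) \<oplus> inv k \<otimes> (\<ominus> c)"
        using carr x ic by algebra
      also have "\<dots> \<in> T <+>\<^bsub>R\<^esub> C"
        using k uT i by (auto simp: set_add_def' intro!: subsp_smult[OF T] subsp_smult[OF C] subsp_neg[OF C])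
      finally show False using x by simp
    qed
    with k carr x have "u = c" by simp
    then have "u \<in> T \<inter> C" using uT k(2) by simp
    then show ?thesis using TC by simp
  qed
  moreover have "\<zero> \<in> T" "\<zero> \<in> line_extension K x C"
    using subsp_zero[OF T] subsp_zero[OF subsp_line_extension[OF C x(1)]] by auto
  ultimately show ?thesis by blast
qed

text \<open>Double counting of the pairs \<open>(x, D)\<close> with \<open>x \<in> D - C\<close>: such an \<open>x\<close> ranges over the vectors
  outside \<open>T + C\<close>, and the spaces \<open>D\<close> belonging to \<open>x\<close> are those above \<open>K x + C\<close>.
  Taking \<open>T = {0}\<close> gives the number of subspaces, taking \<open>C = {0}\<close> the number of complements.\<close>

lemma card_between_disjoint:
  assumes V: "subalgebra K V R" "finite V" and T: "subalgebra K T R" "T \<subseteq> V"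
  shows "subalgebra K C R \<Longrightarrow> C \<subseteq> V \<Longrightarrow> T \<inter> C = {\<zero>} \<Longrightarrow>
    real (card {D. subalgebra K D R \<and> C \<subseteq> D \<and> D \<subseteq> V \<and> card D = card C * q ^ j \<and> T \<inter> D = {\<zero>}}) =
    (\<Prod>i<j. (real (card V) / real (card C) - real (card T) * real q ^ i) / (real q ^ j - real q ^ i))"
proof (induction j arbitrary: C)
  case 0
  then have "{D. subalgebra K D R \<and> C \<subseteq> D \<and> D \<subseteq> V \<and> card D = card C * q ^ 0 \<and> T \<inter> D = {\<zero>}} = {C}"
  proof (intro equalityI subsetI)
    fix D assume "D \<in> {D. subalgebra K D R \<and> C \<subseteq> D \<and> D \<subseteq> V \<and> card D = card C * q ^ 0 \<and> T \<inter> D = {\<zero>}}"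
    then have "finite D" "C \<subseteq> D" "card C = card D" using V finite_subset by auto
    then show "D \<in> {C}" using card_subset_eq by blast
  qed (use 0 in auto)
  then show ?case by simp
next
  case (Suc j)
  let ?X = "\<lambda>C j. {D. subalgebra K D R \<and> C \<subseteq> D \<and> D \<subseteq> V \<and> card D = card C * q ^ j \<and> T \<inter> D = {\<zero>}}"
  let ?P = "\<Prod>i<j. (real (card V) / real (q * card C) - real (card T) * real q ^ i) / (real q ^ j - real q ^ i)"
  note C = Suc.prems
  have fin: "finite (?X C j)" for C j
    using V by (auto intro: finite_subset[of _ "Pow V"])
  have finC: "finite C" using C V finite_subset by blast
  have c0: "0 < card C" using subsp_zero[OF C(1)] finC by (auto simp: card_gt_0_iff)
  have sub: "T <+>\<^bsub>R\<^esub> C \<subseteq> V"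
    using T(2) C(2) subsp_add[OF V(1)] unfolding set_add_def' by blast
  have step: "real (card {D \<in> ?X C (Suc j). x \<in> D}) = ?P" if x: "x \<in> V - (T <+>\<^bsub>R\<^esub> C)" for x
  proof -
    have xc: "x \<in> carrier R" using x subsp_carrier[OF V(1)] by blast
    have "x \<notin> C"
      using x subsp_zero[OF T(1)] subsp_carrier[OF C(1), of x] by (force simp: set_add_def')
    then have card: "card (line_extension K x C) = q * card C"
      using card_line_extension[OF C(1) xc] by simp
    have eq: "{D \<in> ?X C (Suc j). x \<in> D} = ?X (line_extension K x C) j"
      using line_extension_subset_iff[OF C(1) _ xc] card by (auto simp: mult_ac)
    have "line_extension K x C \<subseteq> V"
      using line_extension_subset_iff[OF C(1) V(1) xc] x C(2) by blast
    moreover have "T \<inter> line_extension K x C = {\<zero>}"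
      using line_extension_disjoint[OF T(1) C(1,3) xc] x by blast
    ultimately show ?thesis
      unfolding eq using Suc.IH[OF subsp_line_extension[OF C(1) xc]] by (simp only: card)
  qed
  have "(real (card C) * real q ^ Suc j - real (card C)) * real (card (?X C (Suc j))) =
      (\<Sum>D\<in>?X C (Suc j). real (card (D - C)))"
  proof -
    have "real (card (D - C)) = real (card C) * real q ^ Suc j - real (card C)" if "D \<in> ?X C (Suc j)" for D
    proof -
      have D: "finite D" "C \<subseteq> D" using that V finite_subset by auto
      have "card (D - C) = card D - card C" "card C \<le> card D"
        using card_Diff_subset[OF finC D(2)] card_mono[OF D] by auto
      with that show ?thesis by (simp add: of_nat_diff)
    qed
    then show ?thesis by (simp add: mult.commute)
  qed
  also have "\<dots> = (\<Sum>D\<in>?X C (Suc j). real (card {x \<in> V - (T <+>\<^bsub>R\<^esub> C). x \<in> D}))"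
  proof (rule sum.cong[OF refl])
    fix D assume D: "D \<in> ?X C (Suc j)"
    \<comment> \<open>If \<open>x\<close> in \<open>D\<close> equals \<open>t \<oplus> c\<close>,
      then \<open>t = x \<ominus> c\<close> lies in both \<open>T\<close> and \<open>D\<close>, so
      it is zero and \<open>x\<close> lies in \<open>C\<close>. Thus inside \<open>D\<close>, being
      outside \<open>C\<close> is the same as being outside the sum of \<open>T\<close> and
      \<open>C\<close>.\<close>
    have "D - C = {x \<in> V - (T <+>\<^bsub>R\<^esub> C). x \<in> D}"
    proof safe
      fix x assume x: "x \<in> D" "x \<notin> C" "x \<in> T <+>\<^bsub>R\<^esub> C"
      then obtain t c where tc: "t \<in> T" "c \<in> C" "x = t \<oplus> c" by (auto simp: set_add_def')
      have "t \<in> carrier R" "c \<in> carrier R"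
        using tc subsp_carrier[OF T(1)] subsp_carrier[OF C(1)] by blast+
      then have "t = x \<ominus> c"
        unfolding tc(3) by algebra
      moreover have "x \<ominus> c \<in> D" using x tc D by (auto intro!: subsp_minus[of D])
      ultimately have "t = \<zero>" using tc D by blast
      then show False using tc x \<open>c \<in> carrier R\<close> by simp
    next
      fix x assume "x \<in> C" "x \<notin> T <+>\<^bsub>R\<^esub> C"
      moreover have "x = \<zero> \<oplus> x" using \<open>x \<in> C\<close> subsp_carrier[OF C(1)] by simp
      ultimately show False using subsp_zero[OF T(1)] unfolding set_add_def' by blast
    qed (use D in auto)
    then show "real (card (D - C)) = real (card {x \<in> V - (T <+>\<^bsub>R\<^esub> C). x \<in> D})" by simp
  qed
  also have "\<dots> = (\<Sum>x\<in>V - (T <+>\<^bsub>R\<^esub> C). real (card {D \<in> ?X C (Suc j). x \<in> D}))"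
    using sum_multicount_gen[of "?X C (Suc j)" "V - (T <+>\<^bsub>R\<^esub> C)" "\<lambda>D x. x \<in> D" "\<lambda>x. card {D \<in> ?X C (Suc j). x \<in> D}"]
      fin V by (simp only: of_nat_sum[symmetric]) simp
  also have "\<dots> = real (card (V - (T <+>\<^bsub>R\<^esub> C))) * ?P"
    using step by simp
  also have "real (card (V - (T <+>\<^bsub>R\<^esub> C))) = real (card V) - real (card T) * real (card C)"
  proof -
    have "card (V - (T <+>\<^bsub>R\<^esub> C)) = card V - card (T <+>\<^bsub>R\<^esub> C)" "card (T <+>\<^bsub>R\<^esub> C) \<le> card V"
      using card_Diff_subset[OF finite_subset[OF sub V(2)] sub] card_mono[OF V(2) sub] by auto
    then show ?thesis
      using card_subsp_sum[OF T(1) C(1) C(3)] by (simp add: of_nat_diff)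
  qed
  finally have eq: "(real (card C) * real q ^ Suc j - real (card C)) * real (card (?X C (Suc j))) =
      (real (card V) - real (card T) * real (card C)) * ?P" .
  have "real q ^ Suc j > 1"
    using q_ge_2 by (intro one_less_power) auto
  then have "real (card (?X C (Suc j))) =
      (real (card V) / real (card C) - real (card T)) / (real q ^ Suc j - 1) * ?P"
    using eq c0 by (simp add: field_simps)
  \<comment> \<open>Multiplying numerator and denominator of each factor by \<open>q\<close> shifts
    its index from \<open>i\<close> to \<open>Suc i\<close>. The factor split off in front then
    becomes the one with index 0.\<close>
  also have "?P = (\<Prod>i<j. (real (card V) / real (card C) - real (card T) * real q ^ Suc i) / (real q ^ Suc j - real q ^ Suc i))"
  proof (rule prod.cong[OF refl])
    fix i
    have "(a / (r * c) - t * r ^ i) / (r ^ j - r ^ i) = (a / c - t * r ^ Suc i) / (r ^ Suc j - r ^ Suc i)"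
      if "r > 0" "c > 0" for a r c t :: real
    proof -
      have "(a / c - t * r ^ Suc i) / (r ^ Suc j - r ^ Suc i) = (r * (a / (r * c) - t * r ^ i)) / (r * (r ^ j - r ^ i))"
        using that by (simp add: algebra_simps)
      also have "\<dots> = (a / (r * c) - t * r ^ i) / (r ^ j - r ^ i)"
        using that by (subst mult_divide_mult_cancel_left) auto
      finally show ?thesis by simp
    qed
    from this[of "real q" "real (card C)" "real (card V)" "real (card T)"]
    show "(real (card V) / real (q * card C) - real (card T) * real q ^ i) / (real q ^ j - real q ^ i) =
      (real (card V) / real (card C) - real (card T) * real q ^ Suc i) / (real q ^ Suc j - real q ^ Suc i)"
      using c0 q_ge_2 by simp
  qed
  finally show ?case
    unfolding prod.lessThan_Suc_shift by simp
qed

section \<open>Counts of subspaces and complements, and the triple system built from them\<close>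

definition subspaces where
  "subspaces V n = {E. subalgebra K E R \<and> E \<subseteq> V \<and> card E = q ^ n}"

text \<open>This is the double count with \<open>T\<close> trivial. The spaces counted correspond to
  the \<open>j\<close>-dimensional subspaces of the quotient of \<open>V\<close> by
  \<open>C\<close>, which has dimension \<open>l\<close>. Cancelling \<open>q ^ i\<close> in each
  factor of the product leaves the Gaussian binomial.\<close>

lemma card_subspaces_between:
  assumes V: "subalgebra K V R" "card V = q ^ (c + l)"
    and C: "subalgebra K C R" "C \<subseteq> V" "card C = q ^ c" and "j \<le> l"
  shows "real (card {D \<in> subspaces V (c + j). C \<subseteq> D}) = gauss_binomial q l j"
proof -
  have q: "1 < real q" using q_ge_2 by simp
  have "card V > 0" unfolding V(2) using q_ge_2 by simp
  then have "finite V" by (rule card_ge_0_finite)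
  have z: "\<zero> \<in> E" if "subalgebra K E R" for E using that subsp_zero by blast
  have "{D \<in> subspaces V (c + j). C \<subseteq> D} =
      {D. subalgebra K D R \<and> C \<subseteq> D \<and> D \<subseteq> V \<and> card D = card C * q ^ j \<and> {\<zero>} \<inter> D = {\<zero>}}"
    using z by (auto simp: subspaces_def C power_add)
  then have "real (card {D \<in> subspaces V (c + j). C \<subseteq> D}) =
      (\<Prod>i<j. (real (q ^ (c + l)) / real (q ^ c) - 1 * real q ^ i) / (real q ^ j - real q ^ i))"
    using card_between_disjoint[OF V(1) \<open>finite V\<close> subsp_zero_space _ C(1,2), of j] z[OF C(1)] z[OF V(1)]
    by (simp add: C V)
  also have "\<dots> = gauss_binomial q l j"
    unfolding gauss_binomial_def
  proof (rule prod.cong[OF refl])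
    fix i assume "i \<in> {..<j}"
    then have i: "i \<le> j" "i \<le> l" using \<open>j \<le> l\<close> by auto
    have "real q ^ n - real q ^ i = real q ^ i * (real q ^ (n - i) - 1)" if "i \<le> n" for n
      using that by (simp add: algebra_simps flip: power_add)
    with i q show "(real (q ^ (c + l)) / real (q ^ c) - 1 * real q ^ i) / (real q ^ j - real q ^ i) =
        (real q ^ (l - i) - 1) / (real q ^ (j - i) - 1)"
      by (simp add: power_add)
  qed
  finally show ?thesis .
qed

lemma card_subspaces:
  assumes "subalgebra K V R" "card V = q ^ l" "j \<le> l"
  shows "real (card (subspaces V j)) = gauss_binomial q l j"
proof -
  have "{D \<in> subspaces V (0 + j). {\<zero>} \<subseteq> D} = subspaces V j"
    using subsp_zero by (auto simp: subspaces_def)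
  then show ?thesis
    using card_subspaces_between[of V 0 l "{\<zero>}" j] assms subsp_zero_space subsp_zero by simp
qed

text \<open>This is the double count with \<open>C\<close> trivial, where each of the
  \<open>m\<close> factors collapses to \<open>q ^ t\<close>. The result is symmetric in
  \<open>t\<close> and \<open>m\<close>, so the complement relation has the same degree on both
  sides, as the matching requires.\<close>

lemma card_complements:
  assumes S: "subalgebra K S R" "card S = q ^ (t + m)" and T: "T \<in> subspaces S t"
  shows "card {C \<in> subspaces S m. T \<inter> C = {\<zero>}} = q ^ (t * m)"
proof -
  have q: "1 < real q" using q_ge_2 by simp
  have "card S > 0" unfolding S(2) using q_ge_2 by simp
  then have "finite S" by (rule card_ge_0_finite)
  have T': "subalgebra K T R" "T \<subseteq> S" "card T = q ^ t"
    using T by (auto simp: subspaces_def)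
  have "{C \<in> subspaces S m. T \<inter> C = {\<zero>}} =
      {D. subalgebra K D R \<and> {\<zero>} \<subseteq> D \<and> D \<subseteq> S \<and> card D = card {\<zero>} * q ^ m \<and> T \<inter> D = {\<zero>}}"
    using subsp_zero by (auto simp: subspaces_def)
  then have "real (card {C \<in> subspaces S m. T \<inter> C = {\<zero>}}) =
      (\<Prod>i<m. (real q ^ (t + m) - real q ^ t * real q ^ i) / (real q ^ m - real q ^ i))"
    using card_between_disjoint[OF S(1) \<open>finite S\<close> T'(1,2) subsp_zero_space, of m]
      subsp_zero[OF S(1)] subsp_zero[OF T'(1)] by (simp add: S T')
  also have "\<dots> = (\<Prod>i<m. real q ^ t)"
  proof (rule prod.cong[OF refl])
    fix i assume "i \<in> {..<m}"
    then have "real q ^ i < real q ^ m" using q by simp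
    then show "(real q ^ (t + m) - real q ^ t * real q ^ i) / (real q ^ m - real q ^ i) = real q ^ t"
      by (simp add: power_add field_simps)
  qed
  also have "\<dots> = real (q ^ (t * m))"
    by (simp add: power_mult)
  finally show ?thesis by (simp only: of_nat_eq_iff)
qed

lemma complement_matching:
  assumes S: "subalgebra K S R" "card S = q ^ (m + t)"
  shows "\<exists>g. inj_on g (subspaces S t) \<and> (\<forall>T\<in>subspaces S t. g T \<in> subspaces S m \<and> T \<inter> g T = {\<zero>})"
proof (rule regular_bipartite_matching)
  have "card S > 0" unfolding S(2) using q_ge_2 by simp
  then have "finite (Pow S)" by (simp add: card_ge_0_finite)
  then show "finite (subspaces S t)" "finite (subspaces S m)"
    by (auto simp: subspaces_def intro: finite_subset[of _ "Pow S"])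
  show "0 < q ^ (t * m)" using q_ge_2 by simp
  show "card {C \<in> subspaces S m. T \<inter> C = {\<zero>}} = q ^ (t * m)" if "T \<in> subspaces S t" for T
    using card_complements[OF S(1) _ that] S(2) by (simp add: add.commute)
  show "card {T \<in> subspaces S t. T \<inter> C = {\<zero>}} = q ^ (t * m)" if "C \<in> subspaces S m" for C
    using card_complements[OF S(1) S(2) that] by (simp add: Int_commute mult.commute)
qed

text \<open>Any two members of a triple determine the third: \<open>S\<close> is the sum of
  \<open>T\<close> and \<open>C\<close>, \<open>C\<close> is the image of \<open>T\<close> under the
  matching in \<open>S\<close>, and that matching is injective. The three degree statements count
  the packets that a user misses in each of the three schemes.\<close>

lemma subspace_triple_system:
  assumes V: "subalgebra K V R" "card V = q ^ k" and "m + t \<le> k"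
  obtains H where "triple_system (subspaces V t) (subspaces V m) (subspaces V (m + t)) H"
    and "\<forall>T\<in>subspaces V t. real (card {C. \<exists>S. H T C S}) = gauss_binomial q (k - t) m"
    and "\<forall>T\<in>subspaces V t. real (card {S. \<exists>C. H T C S}) = gauss_binomial q (k - t) m"
    and "\<forall>S\<in>subspaces V (m + t). real (card {T. \<exists>C. H T C S}) = gauss_binomial q (m + t) t"
proof -
  have "card V > 0" unfolding V(2) using q_ge_2 by simp
  then have finV: "finite V" by (rule card_ge_0_finite)
  have "\<forall>S\<in>subspaces V (m + t). \<exists>g. inj_on g (subspaces S t) \<and>
      (\<forall>T\<in>subspaces S t. g T \<in> subspaces S m \<and> T \<inter> g T = {\<zero>})"
    using complement_matching by (auto simp: subspaces_def)
  then obtain g where g: "\<And>S. S \<in> subspaces V (m + t) \<Longrightarrow> inj_on (g S) (subspaces S t)"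
    "\<And>S T. S \<in> subspaces V (m + t) \<Longrightarrow> T \<in> subspaces S t \<Longrightarrow> g S T \<in> subspaces S m \<and> T \<inter> g S T = {\<zero>}"
    by (metis (no_types, lifting))
  define H where "H T C S \<longleftrightarrow> S \<in> subspaces V (m + t) \<and> T \<in> subspaces S t \<and> C = g S T" for T C S
  have dom: "T \<in> subspaces V t \<and> C \<in> subspaces V m \<and> S \<in> subspaces V (m + t)" if "H T C S" for T C S
    using that g(2)[of S T] by (auto simp: H_def subspaces_def)
  \<comment> \<open>The space \<open>S\<close> may differ from the \<open>S'\<close> of the triple.
    Membership in a triple is used only to know that \<open>T\<close> and \<open>C\<close> meet
    trivially. In the proof of \<open>tri\<close> the other two triples supply the inclusions of
    \<open>T\<close> and \<open>C\<close> in \<open>S\<close>.\<close>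
  have sum: "S = T <+>\<^bsub>R\<^esub> C" if h: "H T C S'" and S: "S \<in> subspaces V (m + t)" "T \<subseteq> S" "C \<subseteq> S" for T C S S'
  proof -
    have "T \<inter> C = {\<zero>}" using g(2)[of S' T] h by (auto simp: H_def)
    moreover have "finite S" using S finV by (auto simp: subspaces_def intro: finite_subset)
    ultimately show ?thesis
      using complement_sum[of T C S] dom[OF h] S by (simp add: subspaces_def power_add mult.commute)
  qed
  have sub: "T \<subseteq> S" "C \<subseteq> S" if "H T C S" for T C S
    using that g(2)[of S T] by (auto simp: H_def subspaces_def)
  have tri: "T = T' \<and> C = C' \<and> S = S'" if h: "H T C S'" "H T C' S" "H T' C S" for T C S T' C' S'
  proof -
    have "S = T <+>\<^bsub>R\<^esub> C" "S' = T <+>\<^bsub>R\<^esub> C"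
      using sum[OF h(1)] dom[OF h(1)] dom[OF h(2)] sub[OF h(1)] sub[OF h(2)] sub[OF h(3)] by blast+
    then have "S = S'" by simp
    moreover from this have "C = C'" using h by (simp add: H_def)
    moreover have "T = T'" using g(1)[of S] h calculation by (auto simp: H_def inj_on_def)
    ultimately show ?thesis by blast
  qed
  have above: "real (card {S. \<exists>C. H T C S}) = gauss_binomial q (k - t) m" if T: "T \<in> subspaces V t" for T
  proof -
    have "{S. \<exists>C. H T C S} = {S \<in> subspaces V (t + m). T \<subseteq> S}"
      using T by (auto simp: H_def subspaces_def add.commute)
    then show ?thesis
      using card_subspaces_between[OF V(1), of t "k - t" T m] T V \<open>m + t \<le> k\<close> by (simp add: subspaces_def)
  qed
  have left: "real (card {C. \<exists>S. H T C S}) = gauss_binomial q (k - t) m" if T: "T \<in> subspaces V t" for T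
  proof -
    \<comment> \<open>For fixed \<open>T\<close> the complement determines \<open>S\<close>, so
      there are as many partners \<open>C\<close> as spaces \<open>S\<close> above
      \<open>T\<close>.\<close>
    have "inj_on (\<lambda>S. g S T) {S. \<exists>C. H T C S}"
    proof (rule inj_onI)
      fix S S' assume "S \<in> {S. \<exists>C. H T C S}" "S' \<in> {S. \<exists>C. H T C S}" "g S T = g S' T"
      then have "H T (g S T) S" "H T (g S T) S'" by (auto simp: H_def)
      then show "S = S'" using tri by blast
    qed
    moreover have "(\<lambda>S. g S T) ` {S. \<exists>C. H T C S} = {C. \<exists>S. H T C S}"
      by (auto simp: H_def)
    ultimately show ?thesis using above[OF T] by (metis card_image)
  qed
  have below: "real (card {T. \<exists>C. H T C S}) = gauss_binomial q (m + t) t" if S: "S \<in> subspaces V (m + t)" for S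
  proof -
    have "{T. \<exists>C. H T C S} = subspaces S t" using S by (auto simp: H_def)
    then show ?thesis using card_subspaces[of S "m + t" t] S by (simp add: subspaces_def)
  qed
  have "triple_system (subspaces V t) (subspaces V m) (subspaces V (m + t)) H"
    unfolding triple_system_def using dom tri by metis
  then show thesis
    using that left above below by simp
qed

text \<open>The number of users is called \<open>K'\<close> because \<open>K\<close> denotes the
  scalars of the locale. The type \<open>'f\<close> holds the file symbols and is unrelated to these
  scalars.\<close>

lemma subspace_caching_schemes:
  fixes K' :: nat and M :: real
  assumes V: "subalgebra K V R" "card V = q ^ k" and mt: "m + t \<le> k" and sys: "caching_system K' M N"
  shows "real K' = gauss_binomial q k t \<Longrightarrow>
      M / real N = 1 - gauss_binomial q (k - t) m / gauss_binomial q k m \<Longrightarrow>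
      \<exists>F. real F = gauss_binomial q k m \<and>
        admits_caching_scheme TYPE('f :: {finite, Fields.field}) K' M N F
          (gauss_binomial q k (m + t) / gauss_binomial q k m)" (is "_ \<Longrightarrow> _ \<Longrightarrow> ?scheme1")
    and "real K' = gauss_binomial q k t \<Longrightarrow>
      M / real N = 1 - gauss_binomial q (k - t) m / gauss_binomial q k (m + t) \<Longrightarrow>
      \<exists>F. real F = gauss_binomial q k (m + t) \<and>
        admits_caching_scheme TYPE('f) K' M N F
          (gauss_binomial q k m / gauss_binomial q k (m + t))" (is "_ \<Longrightarrow> _ \<Longrightarrow> ?scheme2")
    and "real K' = gauss_binomial q k (m + t) \<Longrightarrow>
      M / real N = 1 - gauss_binomial q (m + t) t / gauss_binomial q k t \<Longrightarrow>
      \<exists>F. real F = gauss_binomial q k t \<and>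
        admits_caching_scheme TYPE('f) K' M N F
          (gauss_binomial q k m / gauss_binomial q k t)" (is "_ \<Longrightarrow> _ \<Longrightarrow> ?scheme3")
proof -
  obtain H where H: "triple_system (subspaces V t) (subspaces V m) (subspaces V (m + t)) H"
    and deg: "\<forall>T\<in>subspaces V t. real (card {C. \<exists>S. H T C S}) = gauss_binomial q (k - t) m"
      "\<forall>T\<in>subspaces V t. real (card {S. \<exists>C. H T C S}) = gauss_binomial q (k - t) m"
      "\<forall>S\<in>subspaces V (m + t). real (card {T. \<exists>C. H T C S}) = gauss_binomial q (m + t) t"
    by (rule subspace_triple_system[OF V mt])
  have card: "gauss_binomial q k j = real (card (subspaces V j))" if "j \<le> k" for j
    using card_subspaces[OF V that] by simp
  have "card V > 0" unfolding V(2) using q_ge_2 by simp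
  then have finV: "finite (Pow V)" by (simp add: card_ge_0_finite)
  then have fin: "finite (subspaces V j)" for j
    by (auto simp: subspaces_def intro: finite_subset[of _ "Pow V"])
  \<comment> \<open>Positive counts mean nonempty sets of packets, hence a positive
    subpacketization.\<close>
  have gauss_pos: "0 < gauss_binomial q l j" if "j \<le> l" for l j
    using q_ge_2 that unfolding gauss_binomial_def by (intro prod_pos ballI divide_pos_pos) auto
  have ne: "subspaces V j \<noteq> {}" if "j \<le> k" for j
    using gauss_pos[OF that] card[OF that] by auto
  have le: "t \<le> k" "m \<le> k" using mt by auto
  show ?scheme1 if "real K' = gauss_binomial q k t"
    "M / real N = 1 - gauss_binomial q (k - t) m / gauss_binomial q k m"
  proof -
    have K': "K' = card (subspaces V t)" using that(1) card le by simp
    have "admits_caching_scheme TYPE('f) (card (subspaces V t)) M N (card (subspaces V m))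
        (real (card (subspaces V (m + t))) / real (card (subspaces V m)))"
      using that(2) card[OF le(2)] deg(1)
      by (intro triple_system_caching_scheme[OF fin fin fin H _ ne[OF le(2)] sys[unfolded K'],
            where D = "gauss_binomial q (k - t) m"]) simp_all
    then show ?thesis using K' card mt le by auto
  qed
  show ?scheme2 if "real K' = gauss_binomial q k t"
    "M / real N = 1 - gauss_binomial q (k - t) m / gauss_binomial q k (m + t)"
  proof -
    have K': "K' = card (subspaces V t)" using that(1) card le by simp
    have "admits_caching_scheme TYPE('f) (card (subspaces V t)) M N (card (subspaces V (m + t)))
        (real (card (subspaces V m)) / real (card (subspaces V (m + t))))"
      using that(2) card[OF mt] deg(2)
      by (intro triple_system_caching_scheme[OF fin fin fin triple_system_swap23[OF H] _ ne[OF mt] sys[unfolded K'],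
            where D = "gauss_binomial q (k - t) m"]) simp_all
    then show ?thesis using K' card mt le by auto
  qed
  show ?scheme3 if "real K' = gauss_binomial q k (m + t)"
    "M / real N = 1 - gauss_binomial q (m + t) t / gauss_binomial q k t"
  proof -
    have K': "K' = card (subspaces V (m + t))" using that(1) card mt by simp
    have "admits_caching_scheme TYPE('f) (card (subspaces V (m + t))) M N (card (subspaces V t))
        (real (card (subspaces V m)) / real (card (subspaces V t)))"
      using that(2) card[OF le(1)] deg(3)
      by (intro triple_system_caching_scheme[OF fin fin fin triple_system_rotate[OF H] _ ne[OF le(1)] sys[unfolded K'],
            where D = "gauss_binomial q (m + t) t"]) simp_all
    then show ?thesis using K' card mt le by auto
  qed
qed

end

section \<open>Finite fields\<close>

lemma (in cring) binomial:
  assumes x: "x \<in> carrier R" and y: "y \<in> carrier R"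
  shows "(x \<oplus> y) [^] (n::nat) = (\<Oplus>k\<in>{..n}. [(n choose k)] \<cdot> (x [^] k \<otimes> y [^] (n - k)))"
proof (induction n)
  case 0
  then show ?case using x y by simp
next
  case (Suc n)
  let ?f = "\<lambda>k. [(n choose k)] \<cdot> (x [^] k \<otimes> y [^] (n - k))"
  let ?g = "\<lambda>k. [(n choose k)] \<cdot> (x [^] k \<otimes> y [^] (Suc n - k))"
  have fx: "(\<Oplus>k\<in>{..n}. ?f k) \<otimes> x = (\<Oplus>k\<in>{..n}. [(n choose k)] \<cdot> (x [^] Suc k \<otimes> y [^] (n - k)))"
  proof -
    have "?f k \<otimes> x = [(n choose k)] \<cdot> (x [^] Suc k \<otimes> y [^] (n - k))" for k
    proof -
      have "x [^] k \<otimes> y [^] (n - k) \<otimes> x = x [^] Suc k \<otimes> y [^] (n - k)"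
        using x y by (simp add: m_ac)
      then show ?thesis using x y by (simp add: add_pow_ldistr)
    qed
    then show ?thesis using x y by (simp add: finsum_ldistr)
  qed
  have "(\<Oplus>k\<in>{..n}. ?f k) \<otimes> y = (\<Oplus>k\<in>{..n}. ?g k)"
  proof -
    have "?f k \<otimes> y = ?g k" if "k \<le> n" for k
    proof -
      have "x [^] k \<otimes> y [^] (n - k) \<otimes> y = x [^] k \<otimes> y [^] (Suc n - k)"
        using x y that by (simp add: m_assoc Suc_diff_le)
      then show ?thesis using x y by (simp add: add_pow_ldistr)
    qed
    then show ?thesis using x y by (simp add: finsum_ldistr cong: finsum_cong)
  qed
  \<comment> \<open>The added term has coefficient \<open>n choose Suc n = 0\<close>. With it,
    splitting off index 0 gives a sum with the same range as the product with \<open>x\<close>,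
    ready for Pascal's rule.\<close>
  also have "\<dots> = (\<Oplus>k\<in>{..Suc n}. ?g k)"
    using x y by (simp add: binomial_eq_0)
  also have "\<dots> = (\<Oplus>k\<in>{..n}. ?g (Suc k)) \<oplus> ?g 0"
    using x y by (intro finsum_Suc2) auto
  finally have fy: "(\<Oplus>k\<in>{..n}. ?f k) \<otimes> y = (\<Oplus>k\<in>{..n}. ?g (Suc k)) \<oplus> ?g 0" .
  have "(x \<oplus> y) [^] Suc n = (\<Oplus>k\<in>{..n}. ?f k) \<otimes> x \<oplus> (\<Oplus>k\<in>{..n}. ?f k) \<otimes> y"
    using x y by (simp add: Suc.IH r_distr)
  also have "\<dots> = (\<Oplus>k\<in>{..n}. [(n choose k)] \<cdot> (x [^] Suc k \<otimes> y [^] (n - k)) \<oplus> ?g (Suc k)) \<oplus> ?g 0"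
    unfolding fx fy using x y by (subst finsum_addf) (auto simp: a_assoc)
  also have "\<dots> = (\<Oplus>k\<in>{..n}. [(Suc n choose Suc k)] \<cdot> (x [^] Suc k \<otimes> y [^] (Suc n - Suc k))) \<oplus>
      [(Suc n choose 0)] \<cdot> (x [^] (0::nat) \<otimes> y [^] (Suc n - 0))"
    using x y by (simp add: add.nat_pow_mult)
  also have "\<dots> = (\<Oplus>k\<in>{..Suc n}. [(Suc n choose k)] \<cdot> (x [^] k \<otimes> y [^] (Suc n - k)))"
    using x y by (intro finsum_Suc2[symmetric]) auto
  finally show ?case .
qed

text \<open>Stated for commutative rings because Frobenius is applied both in a field and in the
  polynomial ring over it.\<close>

locale char_p_ring = cring R for R (structure) +
  fixes p :: nat
  assumes prime: "Factorial_Ring.prime p" and char: "[p] \<cdot> \<one> = \<zero>"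
begin

lemma add_pow_char:
  assumes "x \<in> carrier R" "p dvd n"
  shows "[n] \<cdot> x = \<zero>"
proof -
  obtain j where n: "n = p * j" using assms(2) by auto
  have "[p] \<cdot> x = ([p] \<cdot> \<one>) \<otimes> x" using assms(1) by (simp add: add_pow_ldistr)
  also have "\<dots> = \<zero>" using assms(1) char by simp
  finally show ?thesis
    unfolding n using assms(1) by (simp add: add.nat_pow_pow[symmetric])
qed

text \<open>The prime \<open>p\<close> divides all binomial coefficients except the two outer ones.
  Writing \<open>p\<close> as \<open>Suc (Suc r)\<close> lets both ends of the sum be split
  off.\<close>

lemma frobenius_add:
  assumes x: "x \<in> carrier R" and y: "y \<in> carrier R"
  shows "(x \<oplus> y) [^] p = x [^] p \<oplus> y [^] p"
proof -
  obtain r where p: "p = Suc (Suc r)"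
    using prime_ge_2_nat[OF prime] by (metis Suc_le_D numeral_2_eq_2 Suc_le_mono)
  let ?f = "\<lambda>k. [(p choose k)] \<cdot> (x [^] k \<otimes> y [^] (p - k))"
  have zero: "?f (Suc k) = \<zero>" if "k \<le> r" for k
  proof -
    have "p dvd (p choose Suc k)"
      using prime that p by (intro dvd_choose_prime) auto
    then show ?thesis using x y by (intro add_pow_char) auto
  qed
  have "(x \<oplus> y) [^] p = (\<Oplus>k\<in>{..Suc (Suc r)}. ?f k)"
    using binomial[OF x y, of p] p by simp
  also have "\<dots> = ?f (Suc (Suc r)) \<oplus> ((\<Oplus>k\<in>{..r}. ?f (Suc k)) \<oplus> ?f 0)"
    using x y by (subst finsum_Suc, simp, subst finsum_Suc2) auto
  also have "(\<Oplus>k\<in>{..r}. ?f (Suc k)) = \<zero>"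
    using zero by (simp add: finsum_zero cong: finsum_cong)
  also have "?f (Suc (Suc r)) \<oplus> (\<zero> \<oplus> ?f 0) = x [^] p \<oplus> y [^] p"
    using x y p by simp
  finally show ?thesis .
qed

lemma frobenius_pow_add:
  assumes x: "x \<in> carrier R" and y: "y \<in> carrier R"
  shows "(x \<oplus> y) [^] (p ^ n) = x [^] (p ^ n) \<oplus> y [^] (p ^ n)"
proof (induction n)
  case (Suc n)
  have "z [^] (p ^ Suc n) = (z [^] (p ^ n)) [^] p" if "z \<in> carrier R" for z
    using that by (simp add: nat_pow_pow mult.commute)
  then show ?case using x y by (simp add: Suc frobenius_add)
qed (use x y in simp)

text \<open>Additivity applied to \<open>x \<ominus> y\<close> and \<open>y\<close> avoids computing
  the power of a negated element, whose sign would depend on the parity of \<open>p\<close>.\<close>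

lemma frobenius_pow_minus:
  assumes x: "x \<in> carrier R" and y: "y \<in> carrier R"
  shows "(x \<ominus> y) [^] (p ^ n) = x [^] (p ^ n) \<ominus> y [^] (p ^ n)"
proof -
  have "x \<ominus> y \<oplus> y = x" using x y by algebra
  then have "(x \<ominus> y) [^] (p ^ n) \<oplus> y [^] (p ^ n) = x [^] (p ^ n)"
    using frobenius_pow_add[of "x \<ominus> y" y n] x y by simp
  moreover have "a = a \<oplus> b \<ominus> b" if "a \<in> carrier R" "b \<in> carrier R" for a b
    using that by algebra
  ultimately show ?thesis using x y by (metis minus_closed nat_pow_closed)
qed

end

lemma (in ring_hom_ring) hom_add_pow:
  "x \<in> carrier R \<Longrightarrow> h ([(n::nat)] \<cdot> x) = [n] \<cdot>\<^bsub>S\<^esub> h x"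
  by (induction n) simp_all

section \<open>Fixed fields of Frobenius powers, and their existence for every prime\<close>

locale char_p_field = field R + char_p_ring R p for R (structure) and p
begin

definition fixed_field :: "nat \<Rightarrow> 'a set" where
  "fixed_field n = {x \<in> carrier R. x [^] (p ^ n) = x}"

lemma fixed_field_subfield: "subfield (fixed_field n) R"
proof (rule subfieldI')
  have pos: "0 < p ^ n" using prime_gt_0_nat[OF prime] by simp
  have zero: "\<zero> [^] (p ^ n) = \<zero>" using pos by (cases "p ^ n") auto
  show "subring (fixed_field n) R"
  proof (rule subringI)
    show "\<ominus> x \<in> fixed_field n" if "x \<in> fixed_field n" for x
      using that frobenius_pow_minus[of \<zero> x n] zero by (simp add: fixed_field_def a_minus_def)
    show "x \<otimes> y \<in> fixed_field n" "x \<oplus> y \<in> fixed_field n"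
      if "x \<in> fixed_field n" "y \<in> fixed_field n" for x y
      using that frobenius_pow_add[of x y n] by (auto simp: fixed_field_def nat_pow_distrib)
  qed (auto simp: fixed_field_def)
  fix k assume k: "k \<in> fixed_field n - {\<zero>}"
  then have u: "k \<in> Units R" and kc: "k \<in> carrier R" and kp: "k [^] (p ^ n) = k"
    by (auto simp: fixed_field_def field_Units)
  then have i: "inv k \<in> carrier R" "k \<otimes> inv k = \<one>" by auto
  \<comment> \<open>The power of the inverse is again an inverse of \<open>k\<close>, so by
    uniqueness of inverses it equals \<open>inv k\<close>.\<close>
  have "k \<otimes> (inv k) [^] (p ^ n) = (k \<otimes> inv k) [^] (p ^ n)"
    using kc i(1) kp by (simp add: nat_pow_distrib)
  also have "\<dots> = \<one>" using i by simp
  finally have "inv k = (inv k) [^] (p ^ n)"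
    using kc i by (intro comm_inv_char) auto
  then show "inv k \<in> fixed_field n" using i by (simp add: fixed_field_def)
qed

lemma fixed_field_mono: "fixed_field n \<subseteq> fixed_field (n * k)"
proof
  fix x assume x: "x \<in> fixed_field n"
  then have "x [^] (p ^ (n * k)) = x" 
  proof (induction k)
    case (Suc k)
    have "x [^] (p ^ (n * Suc k)) = (x [^] (p ^ n)) [^] (p ^ (n * k))"
    proof -
      have "x \<in> carrier R" using x by (simp add: fixed_field_def)
      then show ?thesis by (simp add: nat_pow_pow power_add)
    qed
    with Suc x show ?case by (simp add: fixed_field_def)
  qed (simp add: fixed_field_def)
  with x show "x \<in> fixed_field (n * k)" by (simp add: fixed_field_def)
qed

text \<open>This provides the ambient space: the larger fixed field is a vector space over the
  smaller one, and its dimension is read off from the cardinalities below.\<close>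

lemma fixed_field_subalgebra: "subalgebra (fixed_field n) (fixed_field (n * k)) R"
proof (intro subalgebra.intro subalgebra_axioms.intro)
  note sr = subringE[OF subfieldE(1)[OF fixed_field_subfield]]
  show "subgroup (fixed_field (n * k)) (add_monoid R)"
    by (rule add.subgroupI) (use sr in auto)
  show "x \<otimes> y \<in> fixed_field (n * k)" if "x \<in> fixed_field n" "y \<in> fixed_field (n * k)" for x y
    using that fixed_field_mono sr(6) by blast
qed

text \<open>The roots of \<open>f = X\<^sup>q - X\<close> are simple: if \<open>a\<close> is a root, then
  \<open>f = (X - a)\<^sup>q - (X - a)\<close>.\<close>

lemma card_fixed_field:
  assumes "algebraically_closed R" and "0 < n"
  shows "card (fixed_field n) = p ^ n"
proof -
  define q where "q = p ^ n"
  have q2: "2 \<le> q"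
    using prime_ge_2_nat[OF prime] \<open>0 < n\<close> self_le_power[of p n] unfolding q_def by linarith
  let ?P = "poly_ring R"
  interpret P: domain ?P
    by (rule univ_poly_is_domain[OF carrier_is_subring])
  interpret C: ring_hom_ring R ?P poly_of_const
    using canonical_embedding_ring_hom[OF carrier_is_subring] by simp
  interpret P: char_p_ring ?P p
  proof
    have "[p] \<cdot>\<^bsub>?P\<^esub> \<one>\<^bsub>?P\<^esub> = poly_of_const ([p] \<cdot> \<one>)"
      by (simp add: C.hom_add_pow)
    then show "[p] \<cdot>\<^bsub>?P\<^esub> \<one>\<^bsub>?P\<^esub> = \<zero>\<^bsub>?P\<^esub>"
      using char by simp
  qed (rule prime)
  have X: "X \<in> carrier ?P" using var_closed(1)[OF carrier_is_subring] .
  define f where "f = X [^]\<^bsub>?P\<^esub> q \<ominus>\<^bsub>?P\<^esub> X"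
  have f: "f \<in> carrier ?P" using X by (simp add: f_def)
  have eval: "ring_hom_ring ?P R (\<lambda>g. eval g a)" if "a \<in> carrier R" for a
    using eval_ring_hom[OF carrier_is_subring that] .
  have deg: "degree f = q"
  proof -
    have mon: "X [^]\<^bsub>?P\<^esub> q = monom \<one> q"
      using unitary_monom_eq_var_pow[OF carrier_is_subring] by simp
    have "degree (\<ominus>\<^bsub>?P\<^esub> X) = 1"
      using univ_poly_a_inv_degree[OF carrier_is_subring X] by (simp add: var_def)
    moreover have "degree (X [^]\<^bsub>?P\<^esub> q) = q" unfolding mon monom_def by simp
    moreover have "polynomial (carrier R) (X [^]\<^bsub>?P\<^esub> q)" "polynomial (carrier R) (\<ominus>\<^bsub>?P\<^esub> X)"
      using X by (simp_all only: univ_poly_carrier P.nat_pow_closed P.a_inv_closed)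
    ultimately show ?thesis
      using poly_add_degree_eq[OF carrier_is_subring, of "X [^]\<^bsub>?P\<^esub> q" "\<ominus>\<^bsub>?P\<^esub> X"] q2
      by (simp add: f_def a_minus_def univ_poly_add)
  qed
  then have "f \<noteq> []" using q2 by auto
  have root: "is_root f a \<longleftrightarrow> a \<in> fixed_field n" for a
  proof (cases "a \<in> carrier R")
    case True
    interpret E: ring_hom_ring ?P R "\<lambda>g. eval g a" using eval[OF True] .
    have "eval f a = a [^] q \<ominus> a"
      using X True by (simp add: f_def a_minus_def E.hom_nat_pow eval_var)
    then show ?thesis
      using True \<open>f \<noteq> []\<close> by (simp add: is_root_def fixed_field_def q_def)
  qed (simp add: is_root_def fixed_field_def)
  have simple: "count (roots f) a = 1" if "a \<in># roots f" for a
  proof -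
    have a: "a \<in> carrier R" "a [^] q = a"
      using that root roots_mem_iff_is_root[OF f] by (auto simp: fixed_field_def q_def)
    interpret E: ring_hom_ring ?P R "\<lambda>g. eval g a" using eval[OF a(1)] .
    define l where "l = [\<one>, \<ominus> a]"
    define c where "c = poly_of_const a"
    have l: "l \<in> carrier ?P"
      using a unfolding l_def univ_poly_carrier[symmetric] polynomial_def by auto
    have c: "c \<in> carrier ?P" using a by (simp add: c_def)
    have "l \<oplus>\<^bsub>?P\<^esub> c = X"
      using a by (auto simp: l_def c_def var_def poly_of_const_def univ_poly_add l_neg)
    then have lX: "l = X \<ominus>\<^bsub>?P\<^esub> c"
      using l c by (metis P.add.inv_solve_right P.minus_eq X)
    have cq: "c [^]\<^bsub>?P\<^esub> q = c"
      using a by (simp add: c_def C.hom_nat_pow[symmetric])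
    have lq: "l [^]\<^bsub>?P\<^esub> q = X [^]\<^bsub>?P\<^esub> q \<ominus>\<^bsub>?P\<^esub> c"
      unfolding lX using P.frobenius_pow_minus[OF X c, of n] cq by (simp add: q_def)
    have "X [^]\<^bsub>?P\<^esub> q \<in> carrier ?P" using X by simp
    then have fl: "f = l [^]\<^bsub>?P\<^esub> q \<ominus>\<^bsub>?P\<^esub> l"
      unfolding f_def lq unfolding lX using X c by algebra
    have el: "eval l a = \<zero>" using a by (simp add: l_def r_neg)
    \<comment> \<open>If the square of \<open>l\<close> divided \<open>l ^ q - l\<close>, cancelling
      one \<open>l\<close> would make \<open>l\<close> divide \<open>l ^ (q - 1) - 1\<close>. At the
      root \<open>a\<close> of \<open>l\<close> that polynomial takes the value -1, which is not
      zero.\<close>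
    have "\<not> 2 \<le> alg_mult f a"
    proof
      assume "2 \<le> alg_mult f a"
      then have "l [^]\<^bsub>?P\<^esub> (2::nat) pdivides f"
        using le_alg_mult_imp_pdivides[OF a(1) f] by (simp add: l_def)
      then obtain g where g: "g \<in> carrier ?P" "f = l [^]\<^bsub>?P\<^esub> (2::nat) \<otimes>\<^bsub>?P\<^esub> g"
        by (auto simp: pdivides_def factor_def)
      obtain s where s: "q = Suc (Suc s)"
        using q2 by (metis Suc_le_D numeral_2_eq_2 Suc_le_mono)
      define h where "h = l [^]\<^bsub>?P\<^esub> s"
      have h: "h \<in> carrier ?P" using l by (simp add: h_def)
      have "h \<otimes>\<^bsub>?P\<^esub> l \<otimes>\<^bsub>?P\<^esub> l \<ominus>\<^bsub>?P\<^esub> l = l \<otimes>\<^bsub>?P\<^esub> l \<otimes>\<^bsub>?P\<^esub> g"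
        using g(2) l unfolding fl s by (simp add: h_def numeral_2_eq_2)
      moreover have "h \<otimes>\<^bsub>?P\<^esub> l \<otimes>\<^bsub>?P\<^esub> l \<ominus>\<^bsub>?P\<^esub> l = l \<otimes>\<^bsub>?P\<^esub> (h \<otimes>\<^bsub>?P\<^esub> l \<ominus>\<^bsub>?P\<^esub> \<one>\<^bsub>?P\<^esub>)"
        using l h by algebra
      moreover have "l \<otimes>\<^bsub>?P\<^esub> l \<otimes>\<^bsub>?P\<^esub> g = l \<otimes>\<^bsub>?P\<^esub> (l \<otimes>\<^bsub>?P\<^esub> g)"
        using l g by algebra
      moreover have "l \<noteq> \<zero>\<^bsub>?P\<^esub>" by (simp add: l_def univ_poly_zero)
      ultimately have "h \<otimes>\<^bsub>?P\<^esub> l \<ominus>\<^bsub>?P\<^esub> \<one>\<^bsub>?P\<^esub> = l \<otimes>\<^bsub>?P\<^esub> g"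
        using l h g P.m_lcancel[of l "h \<otimes>\<^bsub>?P\<^esub> l \<ominus>\<^bsub>?P\<^esub> \<one>\<^bsub>?P\<^esub>" "l \<otimes>\<^bsub>?P\<^esub> g"] by simp
      then have "eval (h \<otimes>\<^bsub>?P\<^esub> l \<ominus>\<^bsub>?P\<^esub> \<one>\<^bsub>?P\<^esub>) a = eval (l \<otimes>\<^bsub>?P\<^esub> g) a" by simp
      then have "\<ominus> \<one> = \<zero>"
        using l h g el E.hom_closed by (simp add: a_minus_def)
      then show False by (metis add.inv_eq_1_iff one_closed one_not_zero)
    qed
    moreover have "0 < count (roots f) a" using that by simp
    ultimately show ?thesis
      using fun_cong[OF alg_mult_eq_count_roots[OF f], of a] by linarith
  qed
  \<comment> \<open>With all multiplicities equal to 1, the number of distinct roots is the size of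
    the root multiset, which is the degree \<open>q\<close> because \<open>f\<close> splits.\<close>
  have "size (roots f) = card (set_mset (roots f))"
    unfolding size_multiset_overloaded_eq using simple by simp
  moreover have "set_mset (roots f) = fixed_field n"
    using root roots_mem_iff_is_root[OF f] by blast
  moreover have "size (roots f) = q"
    using algebraically_closed.roots_over_carrier[OF assms(1) f] deg by (simp add: splitted_def)
  ultimately show ?thesis by (simp add: q_def)
qed

end

text \<open>The witness is the algebraic closure of the integers modulo \<open>p\<close>, and the
  type in the statement is that of its elements. The additive group of the prime field has order
  \<open>p\<close>, so \<open>p\<close> times one vanishes there, and the embedding carries this
  over to \<open>L\<close>.\<close>

lemma exists_algebraically_closed_char_p:
  assumes "Factorial_Ring.prime p"
  shows "\<exists>L :: ((int list \<times> nat) multiset \<Rightarrow> int) ring. char_p_field L p \<and> algebraically_closed L"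
proof -
  let ?R = "residue_ring (int p)"
  interpret R: residues_prime p ?R by unfold_locales (simp_all add: assms)
  define L where "L = R.alg_closure"
  have L: "algebraic_closure L (R.indexed_const ` carrier ?R)" "R.indexed_const \<in> ring_hom ?R L"
    unfolding L_def by (rule R.alg_closureE)+
  interpret L: algebraic_closure L "R.indexed_const ` carrier ?R" by fact
  interpret h: ring_hom_ring ?R L R.indexed_const
    using ring_hom_ringI2[OF R.ring_axioms L.ring_axioms L(2)] .
  have "order (add_monoid ?R) = p"
    by (simp add: order_def R.res_carrier_eq)
  moreover have "[order (add_monoid ?R)] \<cdot>\<^bsub>?R\<^esub> \<one>\<^bsub>?R\<^esub> = \<zero>\<^bsub>?R\<^esub>"
    by (rule R.add.pow_order_eq_1) simp
  ultimately have "[p] \<cdot>\<^bsub>L\<^esub> \<one>\<^bsub>L\<^esub> = \<zero>\<^bsub>L\<^esub>"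
    using h.hom_add_pow[of "\<one>\<^bsub>?R\<^esub>" p] by simp
  then have "char_p_field L p"
    using assms by (intro char_p_field.intro char_p_ring.intro char_p_ring_axioms.intro L.field_axioms L.is_cring)
  then show ?thesis using L.algebraically_closed_axioms by blast
qed

theorem theorem3:
  fixes q k m t K N :: nat and M :: real
  assumes "primepow q"
    and "0 < k" and "0 < m" and "0 < t" and "m + t \<le> k"
    and "caching_system K M N"
  shows
    "(real K = gauss_binomial q k t \<and>
      M / real N = 1 - gauss_binomial q (k - t) m / gauss_binomial q k m \<longrightarrow>
        (\<exists>F. real F = gauss_binomial q k m \<and>
             admits_caching_scheme TYPE('f :: {finite, field}) K M N F
               (gauss_binomial q k (m + t) / gauss_binomial q k m)))
     \<and>
     (real K = gauss_binomial q k t \<and>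
      M / real N = 1 - gauss_binomial q (k - t) m / gauss_binomial q k (m + t) \<longrightarrow>
        (\<exists>F. real F = gauss_binomial q k (m + t) \<and>
             admits_caching_scheme TYPE('f) K M N F
               (gauss_binomial q k m / gauss_binomial q k (m + t))))
     \<and>
     (real K = gauss_binomial q k (m + t) \<and>
      M / real N = 1 - gauss_binomial q (m + t) t / gauss_binomial q k t \<longrightarrow>
        (\<exists>F. real F = gauss_binomial q k t \<and>
             admits_caching_scheme TYPE('f) K M N F
               (gauss_binomial q k m / gauss_binomial q k t)))"
proof -
  obtain p n where p: "Factorial_Ring.prime p" and n: "0 < n" and q: "q = p ^ n"
    using assms(1) unfolding primepow_def by auto
  obtain L :: "((int list \<times> nat) multiset \<Rightarrow> int) ring"
    where L: "char_p_field L p" and closed: "algebraically_closed L"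
    using exists_algebraically_closed_char_p[OF p] by blast
  interpret L: char_p_field L p by (rule L)
  have card: "card (L.fixed_field i) = p ^ i" if "0 < i" for i
    using L.card_fixed_field[OF closed that] .
  have "0 < p ^ n" using prime_gt_0_nat[OF p] by simp
  then have "finite (L.fixed_field n)"
    using card[OF n] by (metis card_ge_0_finite)
  then interpret F: finite_scalars L "L.fixed_field n"
    by (intro finite_scalars.intro finite_scalars_axioms.intro L.field_axioms L.fixed_field_subfield)
  have V: "subalgebra (L.fixed_field n) (L.fixed_field (n * k)) L"
    by (rule L.fixed_field_subalgebra)
  \<comment> \<open>Positivity of \<open>k\<close> makes \<open>n * k\<close> positive, so
    \<open>card\<close> applies to the larger fixed field. Its \<open>(p ^ n) ^ k\<close> elements
    say that its dimension is \<open>k\<close>.\<close>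
  have cardV: "card (L.fixed_field (n * k)) = card (L.fixed_field n) ^ k"
    using card n assms(2) by (simp add: power_mult)
  have cardK: "card (L.fixed_field n) = q"
    using card[OF n] q by simp
  note schemes = F.subspace_caching_schemes[OF V cardV assms(5,6), where 'f = 'f, unfolded cardK]
  show ?thesis
    by (intro conjI impI; elim conjE) (rule schemes; assumption)+
qed

end
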